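(* (A) For every smooth convex domain $\mathbf{K}$ in $\mathbb{E}^2$, $H_{\rm sep}(\mathbf{K}) = 4$. (B) For every smooth strictly convex domain $\mathbf{K}$ in $\mathbb{E}^2$ and every integer $n\ge 2$, $c_{\rm sep}(\mathbf{K}, n, 2) = \left\lfloor 2n - 2\sqrt{n}\right\rfloor$.
   Context: $\mathbb{E}^d$ is $d$-dimensional Euclidean space. A $d$-dimensional convex body is a compact convex subset of $\mathbb{E}^d$ with nonempty interior; if $d=2$ it is called a convex domain. A convex body is smooth if at every boundary point it has a unique supporting hyperplane, and strictly convex if its boundary contains no nontrivial line segment. A packing of translates of $\mathbf{K}$ is a family of non-overlapping translates of $\mathbf{K}$ (pairwise disjoint interiors). Two elements touch if they are non-overlapping and intersect. A packing of translates of $\mathbf{K}$ in $\mathbb{E}^d$ is totally separable if any two packing elements can be separated by a hyperplane of $\mathbb{E}^d$ (a line if $d=2$) that is disjoint from the interior of every packing element. The contact graph of a packing is the simple graph whose vertices correspond to the packing elements, two vertices being joined by an edge if and only if the corresponding packing elements touch. The separable Hadwiger number $H_{\rm sep}(\mathbf{K})$ is the maximum number of translates of $\mathbf{K}$ that all touch $\mathbf{K}$ and, together with $\mathbf{K}$, form a totally separable packing in $\mathbb{E}^d$. The maximum separable contact number $c_{\rm sep}(\mathbf{K}, n, d)$ is the maximum number of edges in a contact graph of a totally separable packing of $n$ translates of $\mathbf{K}$ in $\mathbb{E}^d$. *)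

theory Defs
  imports "HOL-Analysis.Analysis" "HOL-Library.Extended_Nat"
begin

definition convex_body :: "'a::euclidean_space set \<Rightarrow> bool" where
  "convex_body K \<longleftrightarrow> compact K \<and> convex K \<and> interior K \<noteq> {}"

definition supporting_hyperplane :: "'a::euclidean_space set \<Rightarrow> 'a \<Rightarrow> 'a set \<Rightarrow> bool" where
  "supporting_hyperplane K x H \<longleftrightarrow>
     x \<in> H \<and> (\<exists>a b. a \<noteq> 0 \<and> H = {y. a \<bullet> y = b} \<and> K \<subseteq> {y. a \<bullet> y \<le> b})"

definition smooth_body :: "'a::euclidean_space set \<Rightarrow> bool" where
  "smooth_body K \<longleftrightarrow> (\<forall>x\<in>frontier K. \<exists>!H. supporting_hyperplane K x H)"

definition strictly_convex_body :: "'a::euclidean_space set \<Rightarrow> bool" where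
  "strictly_convex_body K \<longleftrightarrow> \<not> (\<exists>x y. x \<noteq> y \<and> closed_segment x y \<subseteq> frontier K)"

definition is_translate :: "'a::euclidean_space set \<Rightarrow> 'a set \<Rightarrow> bool" where
  "is_translate K A \<longleftrightarrow> (\<exists>v. A = (+) v ` K)"

definition nonoverlapping :: "'a::euclidean_space set \<Rightarrow> 'a set \<Rightarrow> bool" where
  "nonoverlapping A B \<longleftrightarrow> interior A \<inter> interior B = {}"

definition touch :: "'a::euclidean_space set \<Rightarrow> 'a set \<Rightarrow> bool" where
  "touch A B \<longleftrightarrow> nonoverlapping A B \<and> A \<inter> B \<noteq> {}"

text \<open>A family of translates is modelled as a set of sets. Nothing is lost: members of an indexed
  family of pairwise non-overlapping sets with nonempty interior are distinct.\<close>

definition translative_packing :: "'a::euclidean_space set \<Rightarrow> 'a set set \<Rightarrow> bool" where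
  "translative_packing K P \<longleftrightarrow> (\<forall>A\<in>P. is_translate K A) \<and> pairwise nonoverlapping P"

definition separating_hyperplane :: "'a::euclidean_space set \<Rightarrow> 'a set \<Rightarrow> 'a set \<Rightarrow> bool" where
  "separating_hyperplane A B H \<longleftrightarrow>
     (\<exists>a b. a \<noteq> 0 \<and> H = {x. a \<bullet> x = b} \<and> A \<subseteq> {x. a \<bullet> x \<le> b} \<and> B \<subseteq> {x. a \<bullet> x \<ge> b})"

definition totally_separable_packing :: "'a::euclidean_space set \<Rightarrow> 'a set set \<Rightarrow> bool" where
  "totally_separable_packing K P \<longleftrightarrow> translative_packing K P \<and>
     pairwise (\<lambda>A B. \<exists>H. separating_hyperplane A B H \<and> (\<forall>C\<in>P. H \<inter> interior C = {})) P"

definition contact_edges :: "'a set set \<Rightarrow> 'a::euclidean_space set set set" where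
  "contact_edges P = {{A, B} | A B. A \<in> P \<and> B \<in> P \<and> A \<noteq> B \<and> touch A B}"

text \<open>The supremum is taken in \<^typ>\<open>enat\<close>, so that it is meaningful without a prior bound on the
  number of translates; a finite value is attained, since the set is nonempty (take
  \<open>T = {}\<close>). An infinite admissible \<open>T\<close> would yield \<open>\<infinity>\<close> through its finite subsets.\<close>

definition H_sep :: "'a::euclidean_space set \<Rightarrow> enat" where
  "H_sep K = Sup {enat (card T) | T. finite T \<and> (\<forall>A\<in>T. touch A K) \<and>
     totally_separable_packing K (insert K T)}"

text \<open>The ambient dimension is carried by the type \<^typ>\<open>'a\<close>. The set of values is finite by the
  lemma below, and it is nonempty for every convex body.\<close>

definition c_sep :: "'a::euclidean_space set \<Rightarrow> nat \<Rightarrow> nat" where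
  "c_sep K n = Max {card (contact_edges P) | P. finite P \<and> card P = n \<and>
     totally_separable_packing K P}"

lemma finite_contact_numbers:
  "finite {card (contact_edges P) | P. finite P \<and> card P = n \<and> totally_separable_packing K P}"
proof (rule finite_subset)
  show "{card (contact_edges P) | P. finite P \<and> card P = n \<and> totally_separable_packing K P}
      \<subseteq> {..2 ^ n}"
  proof clarsimp
    fix P :: "'a set set"
    assume "finite P"
    moreover have "contact_edges P \<subseteq> Pow P"
      by (auto simp: contact_edges_def)
    ultimately show "card (contact_edges P) \<le> 2 ^ card P"
      by (metis card_Pow card_mono finite_Pow_iff)
  qed
qed simp

end

(* Let D = K - K and let u1, u2 in D span the largest possible determinant. They form an Auerbach
   frame: D lies in the parallelogram with sides through u1, -u1, u2, -u2 parallel to u2 and u1, so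
   the lattice they generate gives totally separable packings; five of its elements show that
   H_sep is at least 4, and near-square pieces attain the claimed number of contacts.

   For the upper bounds let u, v be translation vectors from a packing element to two neighbours.
   The line separating the two neighbours touches the element and one of them, and since K is smooth
   it is the common tangent at that contact. It follows that the normals a, b at the two contacts
   satisfy a . v <= 0 and b . u <= 0. Two vectors of D in the same half-open quadrant
   of the frame never satisfy this, so there is at most one neighbour per quadrant and H_sep is at
   most 4. Orient each contact into one of the first two quadrants. The first-quadrant contacts form
   p monotone paths covering all n elements, the second-quadrant ones q such paths, so the number of
   contacts is 2n - p - q. Two elements on a common path of both kinds would have to differ by a
   vector in both quadrants up to sign, so n <= p q and p + q >= 2 sqrt n. *)

theory Submission
  imports Defs
begin

section \<open>Translates and the difference body\<close>

text \<open>Translates of \<open>K\<close> by \<open>x\<close> and \<open>y\<close> meet exactly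
  when \<open>y - x\<close> lies here, so contacts become conditions on translation vectors.\<close>

definition diff_body :: "'a::euclidean_space set \<Rightarrow> 'a set" where
  "diff_body K = {x - y | x y. x \<in> K \<and> y \<in> K}"

definition translates :: "'a::euclidean_space set \<Rightarrow> 'a set \<Rightarrow> 'a set set" where
  "translates K X = (\<lambda>v. (+) v ` K) ` X"

text \<open>Keeps an outer normal rather than a hyperplane: the quadrant arguments depend on the
  sign of \<open>a \<bullet> v\<close>.\<close>

definition supports :: "'a::euclidean_space set \<Rightarrow> 'a \<Rightarrow> 'a \<Rightarrow> bool" where
  "supports D a u \<longleftrightarrow> a \<noteq> 0 \<and> u \<in> D \<and> (\<forall>d\<in>D. a \<bullet> d \<le> a \<bullet> u)"

text \<open>Total separability of the translates of \<open>K\<close> by the vectors in \<open>X\<close>, where \<open>D = K - K\<close>. The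
  separating hyperplane is \<open>{x. a \<bullet> x = t + h}\<close> with \<open>h\<close> the maximum of \<open>a\<close> on \<open>K\<close>, and the width
  of \<open>K\<close> in direction \<open>a\<close> is the maximum of \<open>a\<close> on \<open>D\<close>.\<close>

definition tsep :: "'a::euclidean_space set \<Rightarrow> 'a set \<Rightarrow> bool" where
  "tsep D X \<longleftrightarrow> (\<forall>y\<in>X. \<forall>z\<in>X. y \<noteq> z \<longrightarrow>
     (\<exists>a t. a \<noteq> 0 \<and> a \<bullet> y \<le> t \<and> (\<forall>d\<in>D. t + a \<bullet> d \<le> a \<bullet> z) \<and>
        (\<forall>x\<in>X. a \<bullet> x \<le> t \<or> (\<forall>d\<in>D. t + a \<bullet> d \<le> a \<bullet> x))))"

lemma tsepE:
  assumes "tsep D X" "y \<in> X" "z \<in> X" "y \<noteq> z"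
  obtains a t where "a \<noteq> 0" "a \<bullet> y \<le> t" "\<forall>d\<in>D. t + a \<bullet> d \<le> a \<bullet> z"
    "\<forall>x\<in>X. a \<bullet> x \<le> t \<or> (\<forall>d\<in>D. t + a \<bullet> d \<le> a \<bullet> x)"
  using assms(1)[unfolded tsep_def, rule_format, OF assms(2-4)] that by (elim exE conjE)

lemma diff_body_uminus: "d \<in> diff_body K \<Longrightarrow> - d \<in> diff_body K"
  unfolding diff_body_def by (force simp: algebra_simps)

lemma diff_body_minus_commute: "x - y \<in> diff_body K \<Longrightarrow> y - x \<in> diff_body K"
  using diff_body_uminus[of "x - y" K] by simp

lemma convex_body_nonempty: "convex_body K \<Longrightarrow> K \<noteq> {}"
  unfolding convex_body_def using interior_subset by blast

lemma diff_body_ball: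
  assumes "convex_body K"
  obtains e where "e > 0" "cball 0 e \<subseteq> diff_body K"
proof -
  obtain p where "p \<in> interior K"
    using assms unfolding convex_body_def by blast
  then obtain e where e: "e > 0" "cball p e \<subseteq> K"
    using mem_interior_cball by blast
  have "d \<in> diff_body K" if "d \<in> cball 0 e" for d
  proof -
    have "p + d \<in> cball p e"
      using that by (simp add: dist_norm)
    moreover have "p \<in> K"
      using e by auto
    moreover have "d = (p + d) - p" by simp
    ultimately show ?thesis
      using e unfolding diff_body_def by blast
  qed
  then show ?thesis
    using that e by blast
qed

lemma compact_diff_body:
  assumes "convex_body K"
  shows "compact (diff_body K)"
  using compact_differences[of K K] assms unfolding convex_body_def diff_body_def by simp

section \<open>Outer normals of the difference body and smoothness\<close>

text \<open>The origin is interior to the difference body, so a small positive multiple of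
  \<open>a\<close> belongs to it, and the maximum of \<open>a\<close> is at least its value
  there.\<close>

lemma supports_pos:
  assumes "convex_body K" "supports (diff_body K) a u"
  shows "a \<bullet> u > 0"
proof -
  obtain e where e: "e > 0" "cball 0 e \<subseteq> diff_body K"
    using diff_body_ball[OF assms(1)] .
  have a: "a \<noteq> 0"
    using assms(2) unfolding supports_def by simp
  have "(e / norm a) *\<^sub>R a \<in> cball 0 e"
    using e a by simp
  then have "a \<bullet> ((e / norm a) *\<^sub>R a) \<le> a \<bullet> u"
    using e assms(2) unfolding supports_def by blast
  moreover have "a \<bullet> ((e / norm a) *\<^sub>R a) > 0"
    using e a by simp
  ultimately show ?thesis by linarith
qed

text \<open>With \<open>k'\<close> fixed, maximality of \<open>a\<close> over all differences gives
  maximality at \<open>k\<close> over \<open>K\<close>; this carries normals of the difference body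
  over to \<open>K\<close>.\<close>

lemma supporting_line_of_diff_body:
  assumes "supports (diff_body K) a (k - k')" "k \<in> K" "k' \<in> K"
  shows "supporting_hyperplane K k {y. a \<bullet> y = a \<bullet> k}"
proof -
  have "a \<bullet> y \<le> a \<bullet> k" if "y \<in> K" for y
  proof -
    have "y - k' \<in> diff_body K"
      using that assms(3) unfolding diff_body_def by blast
    then have "a \<bullet> (y - k') \<le> a \<bullet> (k - k')"
      using assms(1) unfolding supports_def by blast
    then show ?thesis
      by (simp add: inner_diff_right)
  qed
  moreover have "a \<noteq> 0"
    using assms(1) unfolding supports_def by simp
  ultimately show ?thesis
    unfolding supporting_hyperplane_def by blast
qed

lemma supporting_hyperplane_frontier:
  assumes "supporting_hyperplane K x H" "x \<in> K"
  shows "x \<in> frontier K"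
proof -
  obtain a b where ab: "a \<noteq> 0" "a \<bullet> x = b" "K \<subseteq> {y. a \<bullet> y \<le> b}"
    using assms(1) unfolding supporting_hyperplane_def by auto
  have "interior K \<subseteq> {y. a \<bullet> y < b}"
    using interior_mono[OF ab(3)] interior_halfspace_le[OF ab(1)] by simp
  then have "x \<notin> interior K"
    using ab(2) by auto
  then show ?thesis
    using assms(2) closure_subset unfolding frontier_def by blast
qed

text \<open>The part of \<open>a'\<close> orthogonal to \<open>a\<close> is a direction of the
  common hyperplane, hence also orthogonal to \<open>a'\<close>, hence zero.\<close>

lemma hyperplane_normals_parallel:
  fixes a a' :: "'a::euclidean_space"
  assumes "{y. a \<bullet> y = b} = {y. a' \<bullet> y = b'}" "a \<bullet> k = b" "a \<noteq> 0"
  shows "\<exists>c. a' = c *\<^sub>R a"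
proof -
  define c where "c = (a \<bullet> a') / (a \<bullet> a)"
  define w where "w = a' - c *\<^sub>R a"
  have aw: "a \<bullet> w = 0"
    using assms(3) by (simp add: w_def c_def inner_diff_right)
  have "k + w \<in> {y. a \<bullet> y = b}" "k \<in> {y. a \<bullet> y = b}"
    using assms(2) aw by (simp_all add: inner_add_right)
  then have "k + w \<in> {y. a' \<bullet> y = b'}" "k \<in> {y. a' \<bullet> y = b'}"
    unfolding assms(1) .
  then have "a' \<bullet> w = 0"
    by (simp add: inner_add_right)
  then have "w \<bullet> w = 0"
    using aw by (subst (1) w_def) (simp add: inner_diff_left)
  then show ?thesis
    by (auto simp: w_def)
qed

text \<open>Write \<open>u\<close> as \<open>k - k'\<close>: both normals define supporting
  hyperplanes of \<open>K\<close> at the one point \<open>k\<close>, which smoothness identifies.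
  Positivity on \<open>u\<close> fixes the sign of the factor.\<close>

lemma smooth_supports_unique:
  assumes K: "convex_body K" "smooth_body K"
    and a: "supports (diff_body K) a u" and a': "supports (diff_body K) a' u"
  shows "\<exists>c>0. a' = c *\<^sub>R a"
proof -
  obtain k k' where k: "k \<in> K" "k' \<in> K" "u = k - k'"
    using a unfolding supports_def diff_body_def by blast
  have "supporting_hyperplane K k {y. a \<bullet> y = a \<bullet> k}"
    "supporting_hyperplane K k {y. a' \<bullet> y = a' \<bullet> k}"
    using supporting_line_of_diff_body a a' k by blast+
  moreover from this have "k \<in> frontier K"
    using supporting_hyperplane_frontier k(1) by blast
  ultimately have "{y. a \<bullet> y = a \<bullet> k} = {y. a' \<bullet> y = a' \<bullet> k}"
    using K(2) unfolding smooth_body_def by blast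
  then obtain c where c: "a' = c *\<^sub>R a"
    using hyperplane_normals_parallel[of a "a \<bullet> k" a' "a' \<bullet> k" k] a unfolding supports_def by auto
  have "c * (a \<bullet> u) > 0" "a \<bullet> u > 0"
    using supports_pos[OF K(1)] a a' c by (metis inner_scaleR_left)+
  then show ?thesis
    using c by (auto simp: zero_less_mult_iff)
qed

section \<open>Total separability in terms of translation vectors\<close>

text \<open>If the translates agree, a point \<open>k\<close> of \<open>K\<close> extreme in
  direction \<open>v - w\<close> yields the point \<open>k + (v - w)\<close> of \<open>K\<close>,
  which lies further out unless \<open>v = w\<close>.\<close>

lemma inj_translate:
  assumes "convex_body K"
  shows "inj (\<lambda>v. (+) v ` K)"
proof (rule injI)
  fix v w assume eq: "(+) v ` K = (+) w ` K"
  have "compact K" "K \<noteq> {}"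
    using assms convex_body_nonempty unfolding convex_body_def by auto
  then have "\<exists>k\<in>K. \<forall>y\<in>K. (v - w) \<bullet> y \<le> (v - w) \<bullet> k"
    by (rule continuous_attains_sup) (intro continuous_intros)
  then obtain k where k: "k \<in> K" "\<And>y. y \<in> K \<Longrightarrow> (v - w) \<bullet> y \<le> (v - w) \<bullet> k"
    by blast
  then have "v + k \<in> (+) w ` K"
    using eq by blast
  then obtain y where y: "y \<in> K" "v + k = w + y"
    by blast
  then have "y = k + (v - w)"
    by (simp add: algebra_simps)
  then have "(v - w) \<bullet> (v - w) \<le> 0"
    using k(2)[OF y(1)] by (simp add: inner_add_right)
  then have "v - w = 0"
    by (metis inner_ge_zero inner_eq_zero_iff order_antisym)
  then show "v = w"
    by simp
qed

text \<open>The interior is connected, so it cannot have points on both sides without meeting the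
  hyperplane; a convex set with interior points lies in the closure of its interior.\<close>

lemma interior_on_one_side:
  fixes C :: "'a::euclidean_space set"
  assumes "convex C" "interior C \<noteq> {}" "{x. a \<bullet> x = b} \<inter> interior C = {}"
  shows "C \<subseteq> {x. a \<bullet> x \<le> b} \<or> C \<subseteq> {x. a \<bullet> x \<ge> b}"
proof -
  have conn: "connected (interior C)"
    by (simp add: assms(1) convex_connected convex_interior)
  have sub: "C \<subseteq> closure (interior C)"
    using convex_closure_interior[OF assms(1,2)] closure_subset by metis
  have "interior C \<subseteq> {x. a \<bullet> x < b} \<or> interior C \<subseteq> {x. a \<bullet> x > b}"
  proof (rule ccontr)
    assume "\<not> ?thesis"
    moreover have "\<And>x. x \<in> interior C \<Longrightarrow> a \<bullet> x \<noteq> b"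
      using assms(3) by blast
    ultimately obtain x y where xy: "x \<in> interior C" "y \<in> interior C" "a \<bullet> x \<le> b" "b \<le> a \<bullet> y"
      by (smt (verit, best) mem_Collect_eq subsetI)
    then show False
      using connected_ivt_hyperplane[OF conn xy] assms(3) by blast
  qed
  then have "interior C \<subseteq> {x. a \<bullet> x \<le> b} \<or> interior C \<subseteq> {x. a \<bullet> x \<ge> b}"
    by fastforce
  then show ?thesis
    using closure_minimal[OF _ closed_halfspace_le[of a b]] closure_minimal[OF _ closed_halfspace_ge[of b a]] sub
    by (meson subset_trans)
qed

lemma interior_off_hyperplane:
  fixes C :: "'a::euclidean_space set"
  assumes "a \<noteq> 0" "C \<subseteq> {x. a \<bullet> x \<le> b} \<or> C \<subseteq> {x. a \<bullet> x \<ge> b}"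
  shows "{x. a \<bullet> x = b} \<inter> interior C = {}"
  using assms(2)
proof
  assume "C \<subseteq> {x. a \<bullet> x \<le> b}"
  from interior_mono[OF this] show ?thesis
    using interior_halfspace_le[OF assms(1)] by auto
next
  assume "C \<subseteq> {x. a \<bullet> x \<ge> b}"
  from interior_mono[OF this] show ?thesis
    using interior_halfspace_ge[OF assms(1)] by auto
qed

text \<open>\<open>h\<close> is the value of the support function of \<open>K\<close> at
  \<open>a\<close>. It depends on \<open>a\<close> alone, so one shift of the offset handles all
  translates simultaneously.\<close>

lemma translate_in_halfspace_iff:
  assumes "convex_body K"
  obtains h where
    "\<And>v b. (+) v ` K \<subseteq> {x. a \<bullet> x \<le> b} \<longleftrightarrow> a \<bullet> v \<le> b - h"
    "\<And>v b. (+) v ` K \<subseteq> {x. a \<bullet> x \<ge> b} \<longleftrightarrow> (\<forall>d\<in>diff_body K. b - h + a \<bullet> d \<le> a \<bullet> v)"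
proof -
  have *: "compact K" "K \<noteq> {}"
    using assms convex_body_nonempty unfolding convex_body_def by auto
  have cont: "continuous_on K (\<lambda>y. a \<bullet> y)"
    by (intro continuous_intros)
  obtain p where p: "p \<in> K" "\<And>y. y \<in> K \<Longrightarrow> a \<bullet> y \<le> a \<bullet> p"
    using continuous_attains_sup[OF * cont] by blast
  obtain q where q: "q \<in> K" "\<And>y. y \<in> K \<Longrightarrow> a \<bullet> q \<le> a \<bullet> y"
    using continuous_attains_inf[OF * cont] by blast
  have 1: "(+) v ` K \<subseteq> {x. a \<bullet> x \<le> b} \<longleftrightarrow> a \<bullet> v \<le> b - a \<bullet> p" for v b
    using p by (fastforce simp: inner_add_right)
  \<comment> \<open>\<open>a\<close> attains its maximum on the difference body at
    \<open>p - q\<close>, so the bound over all differences reduces to this one.\<close>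
  have pq: "p - q \<in> diff_body K"
    using p q unfolding diff_body_def by blast
  have le: "a \<bullet> d \<le> a \<bullet> (p - q)" if d: "d \<in> diff_body K" for d
  proof -
    obtain x y where "d = x - y" "x \<in> K" "y \<in> K"
      using d unfolding diff_body_def by blast
    then show ?thesis
      using p(2)[of x] q(2)[of y] by (simp add: inner_diff_right)
  qed
  have "(+) v ` K \<subseteq> {x. a \<bullet> x \<ge> b} \<longleftrightarrow> b - a \<bullet> q \<le> a \<bullet> v" for v b
    using q by (fastforce simp: inner_add_right)
  moreover have "(\<forall>d\<in>diff_body K. b - a \<bullet> p + a \<bullet> d \<le> a \<bullet> v) \<longleftrightarrow>
      b - a \<bullet> p + a \<bullet> (p - q) \<le> a \<bullet> v" for v b
    using pq le by fastforce
  ultimately have 2: "(+) v ` K \<subseteq> {x. a \<bullet> x \<ge> b} \<longleftrightarrow>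
      (\<forall>d\<in>diff_body K. b - a \<bullet> p + a \<bullet> d \<le> a \<bullet> v)" for v b
    by (simp add: inner_diff_right)
  show ?thesis
    using that[OF 1 2] .
qed

lemma convex_body_translate:
  assumes "convex_body K"
  shows "convex ((+) v ` K)" "interior ((+) v ` K) \<noteq> {}"
  using assms unfolding convex_body_def by (auto simp: interior_translation)

text \<open>The hyperplane at offset \<open>b\<close> corresponds to \<open>t = b - h\<close>;
  avoiding the interiors forces every translate to one side, which is the final clause of
  \<open>tsep\<close>.\<close>

lemma tsep_if_totally_separable:
  assumes K: "convex_body K" and P: "totally_separable_packing K (translates K X)"
  shows "tsep (diff_body K) X"
  unfolding tsep_def
proof (intro ballI impI)
  fix y z assume yz: "y \<in> X" "z \<in> X" "y \<noteq> z"
  have "(+) y ` K \<noteq> (+) z ` K"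
    using injD[OF inj_translate[OF K]] yz(3) by blast
  moreover have "(+) y ` K \<in> translates K X" "(+) z ` K \<in> translates K X"
    using yz unfolding translates_def by blast+
  ultimately have "\<exists>H. separating_hyperplane ((+) y ` K) ((+) z ` K) H \<and>
      (\<forall>C\<in>translates K X. H \<inter> interior C = {})"
    using pairwiseD[OF P[unfolded totally_separable_packing_def, THEN conjunct2]] by simp
  then obtain H where H: "separating_hyperplane ((+) y ` K) ((+) z ` K) H"
    "\<And>x. x \<in> X \<Longrightarrow> H \<inter> interior ((+) x ` K) = {}"
    unfolding translates_def by auto
  obtain a b where ab: "a \<noteq> 0" "H = {x. a \<bullet> x = b}" "(+) y ` K \<subseteq> {x. a \<bullet> x \<le> b}"
    "(+) z ` K \<subseteq> {x. a \<bullet> x \<ge> b}"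
    using H(1) unfolding separating_hyperplane_def by blast
  have side: "(+) x ` K \<subseteq> {x. a \<bullet> x \<le> b} \<or> (+) x ` K \<subseteq> {x. a \<bullet> x \<ge> b}" if "x \<in> X" for x
    using interior_on_one_side[OF convex_body_translate[OF K], of a b x] H(2)[OF that] ab(2) by simp
  obtain h where h:
    "\<And>v b. (+) v ` K \<subseteq> {x. a \<bullet> x \<le> b} \<longleftrightarrow> a \<bullet> v \<le> b - h"
    "\<And>v b. (+) v ` K \<subseteq> {x. a \<bullet> x \<ge> b} \<longleftrightarrow> (\<forall>d\<in>diff_body K. b - h + a \<bullet> d \<le> a \<bullet> v)"
    using translate_in_halfspace_iff[OF K, of a] by metis
  show "\<exists>a t. a \<noteq> 0 \<and> a \<bullet> y \<le> t \<and> (\<forall>d\<in>diff_body K. t + a \<bullet> d \<le> a \<bullet> z) \<and>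
        (\<forall>x\<in>X. a \<bullet> x \<le> t \<or> (\<forall>d\<in>diff_body K. t + a \<bullet> d \<le> a \<bullet> x))"
    using ab(1,3,4) side unfolding h by blast
qed

lemma totally_separable_if_tsep:
  assumes K: "convex_body K" and X: "tsep (diff_body K) X"
  shows "totally_separable_packing K (translates K X)"
proof -
  have sep: "\<exists>H. separating_hyperplane ((+) y ` K) ((+) z ` K) H \<and>
      (\<forall>C\<in>translates K X. H \<inter> interior C = {})"
    if yz: "y \<in> X" "z \<in> X" "y \<noteq> z" for y z
  proof -
    obtain a t where at: "a \<noteq> 0" "a \<bullet> y \<le> t" "\<forall>d\<in>diff_body K. t + a \<bullet> d \<le> a \<bullet> z"
      "\<forall>x\<in>X. a \<bullet> x \<le> t \<or> (\<forall>d\<in>diff_body K. t + a \<bullet> d \<le> a \<bullet> x)"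
      using tsepE[OF X yz] .
    obtain h where h:
      "\<And>v b. (+) v ` K \<subseteq> {x. a \<bullet> x \<le> b} \<longleftrightarrow> a \<bullet> v \<le> b - h"
      "\<And>v b. (+) v ` K \<subseteq> {x. a \<bullet> x \<ge> b} \<longleftrightarrow> (\<forall>d\<in>diff_body K. b - h + a \<bullet> d \<le> a \<bullet> v)"
      using translate_in_halfspace_iff[OF K, of a] by metis
    define b where "b = t + h"
    have t: "b - h = t"
      by (simp add: b_def)
    have "{x. a \<bullet> x = b} \<inter> interior ((+) x ` K) = {}" if "x \<in> X" for x
      using bspec[OF at(4) that] h(1)[of x b] h(2)[of x b] t
      by (intro interior_off_hyperplane[OF at(1)]) simp
    moreover have "separating_hyperplane ((+) y ` K) ((+) z ` K) {x. a \<bullet> x = b}"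
      unfolding separating_hyperplane_def using at(1,2,3) h(1)[of y b] h(2)[of z b] t by blast
    ultimately show ?thesis
      unfolding translates_def by blast
  qed
  \<comment> \<open>Non-overlap is a consequence of separation: the interiors lie in opposite open
    half-spaces.\<close>
  have "nonoverlapping A B" if AB: "separating_hyperplane A B H" for A B H :: "'a set"
  proof -
    obtain a b where ab: "a \<noteq> 0" "A \<subseteq> {x. a \<bullet> x \<le> b}" "B \<subseteq> {x. a \<bullet> x \<ge> b}"
      using AB unfolding separating_hyperplane_def by blast
    have "interior A \<subseteq> {x. a \<bullet> x < b}" "interior B \<subseteq> {x. a \<bullet> x > b}"
      using interior_mono[OF ab(2)] interior_mono[OF ab(3)] ab(1)
      by (simp_all add: interior_halfspace_le interior_halfspace_ge)
    then show ?thesis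
      unfolding nonoverlapping_def by fastforce
  qed
  moreover have pw: "pairwise (\<lambda>A B. \<exists>H. separating_hyperplane A B H \<and>
      (\<forall>C\<in>translates K X. H \<inter> interior C = {})) (translates K X)"
    unfolding pairwise_def
  proof (intro ballI impI)
    fix A B assume "A \<in> translates K X" "B \<in> translates K X" "A \<noteq> B"
    then obtain y z where "y \<in> X" "z \<in> X" "y \<noteq> z" "A = (+) y ` K" "B = (+) z ` K"
      unfolding translates_def by blast
    then show "\<exists>H. separating_hyperplane A B H \<and> (\<forall>C\<in>translates K X. H \<inter> interior C = {})"
      using sep by simp
  qed
  ultimately have "pairwise nonoverlapping (translates K X)"
    using pairwise_mono by (smt (verit, best) pairwise_def)
  moreover have "\<forall>A\<in>translates K X. is_translate K A"
    unfolding translates_def is_translate_def by blast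
  ultimately show ?thesis
    unfolding totally_separable_packing_def translative_packing_def using pw by blast
qed

lemma totally_separable_iff_tsep:
  assumes "convex_body K"
  shows "totally_separable_packing K (translates K X) \<longleftrightarrow> tsep (diff_body K) X"
  using assms tsep_if_totally_separable totally_separable_if_tsep by blast

lemma translates_inter_iff: "(+) x ` K \<inter> (+) y ` K \<noteq> {} \<longleftrightarrow> y - x \<in> diff_body K"
proof
  assume "(+) x ` K \<inter> (+) y ` K \<noteq> {}"
  then obtain k k' where "k \<in> K" "k' \<in> K" "x + k = y + k'"
    by blast
  then show "y - x \<in> diff_body K"
    unfolding diff_body_def by (force simp: algebra_simps)
next
  assume "y - x \<in> diff_body K"
  then obtain k k' where k: "k \<in> K" "k' \<in> K" "y - x = k - k'"
    unfolding diff_body_def by blast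
  then have "x + k = y + k'"
    by (simp add: algebra_simps)
  then show "(+) x ` K \<inter> (+) y ` K \<noteq> {}"
    using k by blast
qed

text \<open>Non-overlap is part of the packing property, so touching reduces to
  intersecting.\<close>

lemma touch_translates_iff:
  assumes "convex_body K" "totally_separable_packing K (translates K X)" "x \<in> X" "y \<in> X" "x \<noteq> y"
  shows "touch ((+) x ` K) ((+) y ` K) \<longleftrightarrow> y - x \<in> diff_body K"
proof -
  have "(+) x ` K \<noteq> (+) y ` K"
    using injD[OF inj_translate[OF assms(1)]] assms(5) by blast
  moreover have "(+) x ` K \<in> translates K X" "(+) y ` K \<in> translates K X"
    using assms(3,4) unfolding translates_def by blast+
  moreover have "pairwise nonoverlapping (translates K X)"
    using assms(2) unfolding totally_separable_packing_def translative_packing_def by simp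
  ultimately have "nonoverlapping ((+) x ` K) ((+) y ` K)"
    using pairwiseD by metis
  then show ?thesis
    unfolding touch_def translates_inter_iff by blast
qed

lemma not_touch_self: "convex_body K \<Longrightarrow> \<not> touch K K"
  unfolding convex_body_def touch_def nonoverlapping_def by blast

lemma card_translates: "convex_body K \<Longrightarrow> card (translates K X) = card X"
  unfolding translates_def by (rule card_image[OF inj_on_subset[OF inj_translate subset_UNIV]])

lemma finite_translates_iff: "convex_body K \<Longrightarrow> finite (translates K X) \<longleftrightarrow> finite X"
  unfolding translates_def by (rule finite_image_iff[OF inj_on_subset[OF inj_translate subset_UNIV]])

text \<open>Permits passing from an arbitrary packing to its set of translation vectors.\<close>

lemma family_eq_translates:
  assumes "\<forall>A\<in>P. is_translate K A"
  shows "P = translates K {v. (+) v ` K \<in> P}"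
proof (intro equalityI subsetI)
  fix A assume "A \<in> P"
  moreover from this obtain v where "A = (+) v ` K"
    using assms unfolding is_translate_def by blast
  ultimately show "A \<in> translates K {v. (+) v ` K \<in> P}"
    unfolding translates_def by simp
qed (auto simp: translates_def)

section \<open>Neighbours of a packing element\<close>

text \<open>A contact leaves the separating hyperplane no slack: membership of \<open>y - x\<close>
  in \<open>D\<close> forces \<open>t = a \<bullet> x\<close>. This makes \<open>a\<close> an outer
  normal at \<open>y - x\<close> and leaves no element strictly between the levels of
  \<open>x\<close> and \<open>y\<close>.\<close>

lemma contact_supports:
  assumes "tsep D X" "x \<in> X" "y \<in> X" "x \<noteq> y" "y - x \<in> D"
  shows "\<exists>a. supports D a (y - x) \<and> (\<forall>z\<in>X. a \<bullet> z \<le> a \<bullet> x \<or> a \<bullet> y \<le> a \<bullet> z)"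
proof -
  obtain a t where at: "a \<noteq> 0" "a \<bullet> x \<le> t" "\<forall>d\<in>D. t + a \<bullet> d \<le> a \<bullet> y"
    "\<forall>z\<in>X. a \<bullet> z \<le> t \<or> (\<forall>d\<in>D. t + a \<bullet> d \<le> a \<bullet> z)"
    using tsepE[OF assms(1-4)] .
  have "t + a \<bullet> (y - x) \<le> a \<bullet> y"
    using at(3) assms(5) by blast
  then have t: "t = a \<bullet> x"
    using at(2) by (simp add: inner_diff_right)
  have "supports D a (y - x)"
    using at(1,3) assms(5) t unfolding supports_def by (auto simp: inner_diff_right)
  moreover have "a \<bullet> z \<le> a \<bullet> x \<or> a \<bullet> y \<le> a \<bullet> z" if "z \<in> X" for z
    using bspec[OF at(4) that] assms(5) t by (fastforce simp: inner_diff_right)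
  ultimately show ?thesis by blast
qed

text \<open>Whichever side of the line separating the two neighbours \<open>y\<close> and \<open>z\<close> contains \<open>x\<close>, that line
  also separates \<open>x\<close> from one of them.\<close>

lemma neighbours_separated:
  assumes X: "tsep (diff_body K) X"
    and mem: "x \<in> X" "y \<in> X" "z \<in> X" "y \<noteq> z" and dy: "y - x \<in> diff_body K" and dz: "z - x \<in> diff_body K"
  shows "(\<exists>a. supports (diff_body K) a (z - x) \<and> a \<bullet> (y - x) \<le> 0) \<or>
         (\<exists>a. supports (diff_body K) a (y - x) \<and> a \<bullet> (z - x) \<le> 0)"
proof -
  obtain a t where at: "a \<noteq> 0" "a \<bullet> y \<le> t" "\<forall>d\<in>diff_body K. t + a \<bullet> d \<le> a \<bullet> z"
    "a \<bullet> x \<le> t \<or> (\<forall>d\<in>diff_body K. t + a \<bullet> d \<le> a \<bullet> x)"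
    using tsepE[OF X mem(2,3,4)] mem(1) by metis
  from at(4) show ?thesis
  proof
    \<comment> \<open>Here \<open>x\<close> is on the side of \<open>y\<close>; its contact with
      \<open>z\<close> pins the hyperplane at \<open>t = a \<bullet> x\<close>.\<close>
    assume "a \<bullet> x \<le> t"
    moreover have "t + a \<bullet> (z - x) \<le> a \<bullet> z"
      using at(3) dz by blast
    ultimately have t: "t = a \<bullet> x"
      by (simp add: inner_diff_right)
    have "supports (diff_body K) a (z - x)"
      using at(1,3) dz t unfolding supports_def by (auto simp: inner_diff_right)
    then show ?thesis
      using at(2) t by (auto simp: inner_diff_right)
  next
    \<comment> \<open>Here \<open>x\<close> is on the side of \<open>z\<close>; its contact with
      \<open>y\<close> pins \<open>t = a \<bullet> y\<close>, and \<open>- a\<close> is an outer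
      normal at \<open>y - x\<close>.\<close>
    assume *: "\<forall>d\<in>diff_body K. t + a \<bullet> d \<le> a \<bullet> x"
    have dy': "x - y \<in> diff_body K"
      using diff_body_uminus[OF dy] by simp
    then have "t + a \<bullet> (x - y) \<le> a \<bullet> x"
      using * by blast
    then have t: "t = a \<bullet> y"
      using at(2) by (simp add: inner_diff_right)
    have "(- a) \<bullet> d \<le> (- a) \<bullet> (y - x)" if "d \<in> diff_body K" for d
      using *[rule_format, OF diff_body_uminus[OF that]] t by (simp add: inner_diff_right)
    then have "supports (diff_body K) (- a) (y - x)"
      using at(1) dy unfolding supports_def by simp
    moreover have "(- a) \<bullet> (z - x) \<le> 0"
      using at(3)[rule_format, OF dy'] t by (simp add: inner_diff_right)
    ultimately show ?thesis by blast
  qed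
qed

text \<open>The hyperplane at the contact with \<open>y\<close> could fail only with
  \<open>z\<close> beyond \<open>y\<close>. Then its normal \<open>b\<close> would also be a normal
  at \<open>z - x\<close>, hence by smoothness a positive multiple of \<open>a\<close>,
  contradicting \<open>b \<bullet> (y - x) > 0\<close>.\<close>

lemma neighbour_normal:
  assumes K: "convex_body K" "smooth_body K" and X: "tsep (diff_body K) X"
    and mem: "x \<in> X" "y \<in> X" "z \<in> X" "x \<noteq> y"
    and dy: "y - x \<in> diff_body K" and dz: "z - x \<in> diff_body K"
    and a: "supports (diff_body K) a (z - x)" "a \<bullet> (y - x) \<le> 0"
  shows "\<exists>b. supports (diff_body K) b (y - x) \<and> b \<bullet> (z - x) \<le> 0"
proof -
  obtain b where b: "supports (diff_body K) b (y - x)" "b \<bullet> z \<le> b \<bullet> x \<or> b \<bullet> y \<le> b \<bullet> z"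
    using contact_supports[OF X mem(1,2,4) dy] mem(3) by blast
  have "\<not> b \<bullet> y \<le> b \<bullet> z"
  proof
    assume "b \<bullet> y \<le> b \<bullet> z"
    then have "supports (diff_body K) b (z - x)"
      using b(1) dz unfolding supports_def by (fastforce simp: inner_diff_right)
    then obtain c where "c > 0" "b = c *\<^sub>R a"
      using smooth_supports_unique[OF K a(1)] by blast
    then have "b \<bullet> (y - x) \<le> 0"
      using a(2) by (simp add: mult_le_0_iff)
    then show False
      using supports_pos[OF K(1) b(1)] by simp
  qed
  then show ?thesis
    using b by (auto simp: inner_diff_right)
qed

text \<open>One of the two inequalities comes from a hyperplane separating \<open>y\<close> and
  \<open>z\<close>; smoothness yields the other, so the relation between the neighbours becomes
  symmetric.\<close>

lemma neighbours_normals: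
  assumes K: "convex_body K" "smooth_body K" and X: "tsep (diff_body K) X"
    and mem: "x \<in> X" "y \<in> X" "z \<in> X" "y \<noteq> z" "x \<noteq> y" "x \<noteq> z"
    and dy: "y - x \<in> diff_body K" and dz: "z - x \<in> diff_body K"
  shows "\<exists>a b. supports (diff_body K) a (y - x) \<and> a \<bullet> (z - x) \<le> 0 \<and>
      supports (diff_body K) b (z - x) \<and> b \<bullet> (y - x) \<le> 0"
  using neighbours_separated[OF X mem(1-4) dy dz]
    neighbour_normal[OF K X mem(1,2,3) mem(5) dy dz]
    neighbour_normal[OF K X mem(1,3,2) mem(6) dz dy] by blast

section \<open>Auerbach frames and their quadrants\<close>

text \<open>\<open>a1\<close>, \<open>a2\<close> are the coordinate functionals of the basis
  \<open>u1\<close>, \<open>u2\<close>; the bounds place \<open>D\<close> in the circumscribed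
  parallelogram. The last clause makes the space two-dimensional without fixing its type.\<close>

definition auerbach_frame ::
    "'a::euclidean_space set \<Rightarrow> 'a \<Rightarrow> 'a \<Rightarrow> 'a \<Rightarrow> 'a \<Rightarrow> bool" where
  "auerbach_frame D u1 u2 a1 a2 \<longleftrightarrow> u1 \<in> D \<and> u2 \<in> D \<and>
     a1 \<bullet> u1 = 1 \<and> a1 \<bullet> u2 = 0 \<and> a2 \<bullet> u1 = 0 \<and> a2 \<bullet> u2 = 1 \<and>
     (\<forall>d\<in>D. \<bar>a1 \<bullet> d\<bar> \<le> 1 \<and> \<bar>a2 \<bullet> d\<bar> \<le> 1) \<and>
     (\<forall>v. v = (a1 \<bullet> v) *\<^sub>R u1 + (a2 \<bullet> v) *\<^sub>R u2)"

text \<open>Half-open, so that the four quarter turns partition the nonzero vectors.\<close>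

definition quadrant :: "'a::euclidean_space \<Rightarrow> 'a \<Rightarrow> 'a set" where
  "quadrant a1 a2 = {v. a1 \<bullet> v > 0 \<and> a2 \<bullet> v \<ge> 0}"

text \<open>A quarter turn is again a frame, so facts about one quadrant apply to all four.\<close>

lemma auerbach_frame_rotate:
  assumes "auerbach_frame (diff_body K) u1 u2 a1 a2"
  shows "auerbach_frame (diff_body K) u2 (- u1) a2 (- a1)"
  using assms unfolding auerbach_frame_def by (simp add: add.commute diff_body_uminus)

text \<open>Replacing one of \<open>u1\<close>, \<open>u2\<close> by \<open>d\<close> or
  \<open>- d\<close> cannot raise the maximal determinant \<Delta>, so the coordinates of
  \<open>d\<close>, which are determinants divided by \<Delta>, are at most 1 in absolute
  value.\<close>

lemma auerbach_frame_exists: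
  fixes K :: "(real ^ 2) set"
  assumes K: "convex_body K"
  obtains u1 u2 a1 a2 where "auerbach_frame (diff_body K) u1 u2 a1 a2"
proof -
  define D where "D = diff_body K"
  define dt :: "real^2 \<Rightarrow> real^2 \<Rightarrow> real" where "dt u v = u$1 * v$2 - u$2 * v$1" for u v
  obtain e where e: "e > 0" "cball 0 e \<subseteq> D"
    using diff_body_ball[OF K] unfolding D_def .
  have axes: "axis 1 e \<in> D" "axis 2 e \<in> D"
    using e by (auto simp: subset_eq norm_eq_sqrt_inner inner_axis_axis)
  then have DD: "compact (D \<times> D)" "D \<times> D \<noteq> {}"
    using compact_diff_body[OF K] by (auto simp: D_def compact_Times)
  have "continuous_on (D \<times> D) (\<lambda>p. dt (fst p) (snd p))"
    unfolding dt_def by (intro continuous_intros)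
  from continuous_attains_sup[OF DD this] obtain p where p: "p \<in> D \<times> D"
    "\<And>q. q \<in> D \<times> D \<Longrightarrow> dt (fst q) (snd q) \<le> dt (fst p) (snd p)"
    by blast
  define u1 where "u1 = fst p"
  define u2 where "u2 = snd p"
  define \<Delta> where "\<Delta> = dt u1 u2"
  have u: "u1 \<in> D" "u2 \<in> D"
    using p(1) by (auto simp: u1_def u2_def mem_Times_iff)
  have le: "dt x y \<le> \<Delta>" if "x \<in> D" "y \<in> D" for x y
    using p(2)[of "(x, y)"] that by (simp add: \<Delta>_def u1_def u2_def)
  \<comment> \<open>A pair of axis vectors in the inner ball shows that the maximum is positive and
    may serve as a divisor.\<close>
  have "dt (axis 1 e) (axis 2 e) = e * e"
    by (simp add: dt_def axis_def)
  then have pos: "\<Delta> > 0"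
    using le[OF axes] e(1) by (metis mult_pos_pos less_le_trans)
  \<comment> \<open>Cramer's rule supplies the coordinate functionals.\<close>
  define a1 :: "real^2" where "a1 = vector [u2$2 / \<Delta>, - u2$1 / \<Delta>]"
  define a2 :: "real^2" where "a2 = vector [- u1$2 / \<Delta>, u1$1 / \<Delta>]"
  have a1: "a1 \<bullet> v = dt v u2 / \<Delta>" for v
    by (simp add: a1_def dt_def inner_vec_def sum_2 diff_divide_distrib mult.commute)
  have a2: "a2 \<bullet> v = dt u1 v / \<Delta>" for v
    by (simp add: a2_def dt_def inner_vec_def sum_2 diff_divide_distrib mult.commute)
  have neg: "- d \<in> D" if "d \<in> D" for d
    using that diff_body_uminus unfolding D_def by blast
  have dtneg: "dt (- x) y = - dt x y" "dt x (- y) = - dt x y" for x y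
    by (simp_all add: dt_def)
  have "\<bar>dt d u2\<bar> \<le> \<Delta>" "\<bar>dt u1 d\<bar> \<le> \<Delta>" if "d \<in> D" for d
    using le[OF that u(2)] le[OF neg[OF that] u(2)] le[OF u(1) that] le[OF u(1) neg[OF that]]
    by (auto simp: dtneg)
  then have bound: "\<bar>a1 \<bullet> d\<bar> \<le> 1" "\<bar>a2 \<bullet> d\<bar> \<le> 1" if "d \<in> D" for d
    using that pos by (simp_all add: a1 a2)
  have self: "dt x x = 0" for x
    by (simp add: dt_def)
  have "\<Delta> *\<^sub>R v = dt v u2 *\<^sub>R u1 + dt u1 v *\<^sub>R u2" for v
    by (simp add: \<Delta>_def dt_def vec_eq_iff forall_2 algebra_simps)
  then have "v = (1 / \<Delta>) *\<^sub>R (dt v u2 *\<^sub>R u1 + dt u1 v *\<^sub>R u2)" for v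
    using pos by (metis (no_types) divide_self less_irrefl mult.commute scaleR_one scaleR_scaleR
        times_divide_eq_right mult_1_right)
  then have "v = (a1 \<bullet> v) *\<^sub>R u1 + (a2 \<bullet> v) *\<^sub>R u2" for v
    unfolding a1 a2 by (simp add: scaleR_add_right)
  then have "auerbach_frame D u1 u2 a1 a2"
    using u bound pos unfolding auerbach_frame_def by (simp add: a1 a2 self \<Delta>_def[symmetric])
  then show ?thesis
    using that unfolding D_def by blast
qed

text \<open>Both coordinates of \<open>u\<close> are in [0,1]. Were \<open>a\<close> negative at
  \<open>u1\<close>, its value at \<open>u\<close> would drop strictly below that at
  \<open>u2\<close>, against maximality; for \<open>u2\<close> the same comparison leaves one
  boundary case, settled by smoothness.\<close>

lemma quadrant_normal:
  assumes K: "convex_body K" "smooth_body K"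
    and fr: "auerbach_frame (diff_body K) u1 u2 a1 a2"
    and a: "supports (diff_body K) a u" and u: "u \<in> quadrant a1 a2"
  shows "a \<bullet> u1 \<ge> 0" "a \<bullet> u2 \<ge> 0"
proof -
  define \<alpha> where "\<alpha> = a1 \<bullet> u"
  define \<beta> where "\<beta> = a2 \<bullet> u"
  have ud: "u = \<alpha> *\<^sub>R u1 + \<beta> *\<^sub>R u2"
    using fr unfolding auerbach_frame_def \<alpha>_def \<beta>_def by blast
  have uD: "u \<in> diff_body K" "u1 \<in> diff_body K" "u2 \<in> diff_body K"
    using a fr unfolding supports_def auerbach_frame_def by blast+
  have ab: "0 < \<alpha>" "0 \<le> \<beta>" "\<alpha> \<le> 1" "\<beta> \<le> 1"
    using u uD(1) fr unfolding quadrant_def auerbach_frame_def \<alpha>_def \<beta>_def by (auto simp: abs_le_iff)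
  have s: "a \<bullet> u = \<alpha> * (a \<bullet> u1) + \<beta> * (a \<bullet> u2)"
    by (subst ud) (simp add: inner_add_right)
  have pos: "a \<bullet> u > 0"
    using supports_pos[OF K(1) a] .
  have ge: "a \<bullet> u1 \<le> a \<bullet> u" "a \<bullet> u2 \<le> a \<bullet> u"
    using a uD unfolding supports_def by blast+
  show "a \<bullet> u1 \<ge> 0"
  proof (rule ccontr)
    assume neg: "\<not> a \<bullet> u1 \<ge> 0"
    then have "\<alpha> * (a \<bullet> u1) < 0"
      using ab by (simp add: mult_less_0_iff)
    moreover from this have "a \<bullet> u2 > 0"
      using s pos ab by (smt (verit) mult_nonneg_nonpos)
    moreover from this have "\<beta> * (a \<bullet> u2) \<le> a \<bullet> u2"
      using ab by simp
    ultimately show False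
      using s ge by linarith
  qed
  show "a \<bullet> u2 \<ge> 0"
  proof (rule ccontr)
    assume neg: "\<not> a \<bullet> u2 \<ge> 0"
    then have b: "\<beta> * (a \<bullet> u2) \<le> 0"
      using ab by (simp add: mult_le_0_iff)
    then have p: "a \<bullet> u1 > 0"
      using s pos ab by (smt (verit) mult_nonneg_nonpos)
    then have "\<alpha> * (a \<bullet> u1) \<le> a \<bullet> u1"
      using ab by simp
    \<comment> \<open>The half-open quadrant contains \<open>u1\<close>, where equality can occur.
      There \<open>a1\<close> is a normal as well, so \<open>a\<close> is a multiple of it and
      vanishes at \<open>u2\<close>.\<close>
    then have "\<beta> * (a \<bullet> u2) = 0" "\<alpha> * (a \<bullet> u1) = a \<bullet> u1"
      using s ge b by linarith+
    then have "\<beta> = 0" "\<alpha> = 1"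
      using neg p by auto
    then have "u = u1"
      using ud by simp
    moreover have "supports (diff_body K) a1 u1"
      using fr unfolding supports_def auerbach_frame_def by (auto simp: abs_le_iff)
    ultimately obtain c where "a = c *\<^sub>R a1"
      using smooth_supports_unique[OF K] a by blast
    then show False
      using neg fr unfolding auerbach_frame_def by simp
  qed
qed

text \<open>Normals at quadrant vectors are nonnegative on the frame, so a nonpositive value on
  another quadrant vector forces each term to vanish. Done for both normals, this leaves
  \<open>v\<close> on the axis of \<open>u1\<close>, where \<open>b\<close> is zero.\<close>

lemma quadrant_contacts_disjoint:
  assumes K: "convex_body K" "smooth_body K"
    and fr: "auerbach_frame (diff_body K) u1 u2 a1 a2"
    and a: "supports (diff_body K) a u" "a \<bullet> v \<le> 0" and b: "supports (diff_body K) b v" "b \<bullet> u \<le> 0"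
    and u: "u \<in> quadrant a1 a2" and v: "v \<in> quadrant a1 a2"
  shows False
proof -
  have key: "f \<bullet> u1 = 0 \<and> a2 \<bullet> y = 0"
    if f: "supports (diff_body K) f x" "f \<bullet> y \<le> 0" "x \<in> quadrant a1 a2" "y \<in> quadrant a1 a2" for f x y
  proof -
    have nn: "f \<bullet> u1 \<ge> 0" "f \<bullet> u2 \<ge> 0"
      using quadrant_normal[OF K fr f(1,3)] .
    have dec: "f \<bullet> w = (a1 \<bullet> w) * (f \<bullet> u1) + (a2 \<bullet> w) * (f \<bullet> u2)" for w
    proof -
      have "w = (a1 \<bullet> w) *\<^sub>R u1 + (a2 \<bullet> w) *\<^sub>R u2"
        using fr unfolding auerbach_frame_def by blast
      then have "f \<bullet> w = f \<bullet> ((a1 \<bullet> w) *\<^sub>R u1 + (a2 \<bullet> w) *\<^sub>R u2)"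
        by simp
      then show ?thesis
        by (simp add: inner_add_right)
    qed
    have q: "a1 \<bullet> y > 0" "a2 \<bullet> y \<ge> 0"
      using f(4) unfolding quadrant_def by auto
    have "(a1 \<bullet> y) * (f \<bullet> u1) \<ge> 0" "(a2 \<bullet> y) * (f \<bullet> u2) \<ge> 0"
      using nn q by simp_all
    then have z: "(a1 \<bullet> y) * (f \<bullet> u1) = 0" "(a2 \<bullet> y) * (f \<bullet> u2) = 0"
      using dec[of y] f(2) by linarith+
    then have f1: "f \<bullet> u1 = 0"
      using q by simp
    \<comment> \<open>\<open>f\<close> is positive at \<open>x\<close>, so it cannot vanish on both
      frame vectors.\<close>
    moreover have "f \<bullet> u2 \<noteq> 0"
      using dec[of x] supports_pos[OF K(1) f(1)] f1 by auto
    ultimately show ?thesis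
      using z by simp
  qed
  have "b \<bullet> u1 = 0" "a2 \<bullet> v = 0"
    using key[OF a u v] key[OF b v u] by auto
  moreover have "v = (a1 \<bullet> v) *\<^sub>R u1 + (a2 \<bullet> v) *\<^sub>R u2"
    using fr unfolding auerbach_frame_def by blast
  ultimately have "v = (a1 \<bullet> v) *\<^sub>R u1"
    by simp
  then have "b \<bullet> v = (a1 \<bullet> v) * (b \<bullet> u1)"
    by (metis inner_scaleR_right)
  then show False
    using \<open>b \<bullet> u1 = 0\<close> supports_pos[OF K(1) b(1)] by simp
qed

lemma quadrant_neighbour_unique:
  assumes K: "convex_body K" "smooth_body K"
    and fr: "auerbach_frame (diff_body K) u1 u2 a1 a2" and X: "tsep (diff_body K) X"
    and mem: "x \<in> X" "y \<in> X" "z \<in> X"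
    and dy: "y - x \<in> diff_body K \<inter> quadrant a1 a2" and dz: "z - x \<in> diff_body K \<inter> quadrant a1 a2"
  shows "y = z"
proof (rule ccontr)
  assume "y \<noteq> z"
  moreover have "x \<noteq> y" "x \<noteq> z"
    using dy dz by (auto simp: quadrant_def)
  ultimately obtain a b where "supports (diff_body K) a (y - x)" "a \<bullet> (z - x) \<le> 0"
    "supports (diff_body K) b (z - x)" "b \<bullet> (y - x) \<le> 0"
    using neighbours_normals[OF K X mem] dy dz by blast
  then show False
    using quadrant_contacts_disjoint[OF K fr] dy dz by blast
qed

lemma quadrants_cover:
  assumes "auerbach_frame D u1 u2 a1 a2" "v \<noteq> 0"
  shows "v \<in> quadrant a1 a2 \<union> quadrant a2 (- a1) \<union> quadrant (- a1) (- a2) \<union> quadrant (- a2) a1"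
proof -
  have "v = (a1 \<bullet> v) *\<^sub>R u1 + (a2 \<bullet> v) *\<^sub>R u2"
    using assms(1) unfolding auerbach_frame_def by blast
  then have "a1 \<bullet> v \<noteq> 0 \<or> a2 \<bullet> v \<noteq> 0"
    using assms(2) by fastforce
  then show ?thesis
    by (auto simp: quadrant_def)
qed

text \<open>Each quadrant based at \<open>x\<close> holds at most one neighbour; the three rotated
  frames carry this to the other quadrants.\<close>

lemma neighbours_le_4:
  assumes K: "convex_body K" "smooth_body K"
    and fr: "auerbach_frame (diff_body K) u1 u2 a1 a2" and X: "tsep (diff_body K) X"
    and x: "x \<in> X" and Y: "Y \<subseteq> X - {x}" "\<And>y. y \<in> Y \<Longrightarrow> y - x \<in> diff_body K"
  shows "card Y \<le> 4"
proof -
  note rot = auerbach_frame_rotate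
  define N where "N b1 b2 = {y \<in> Y. y - x \<in> quadrant b1 b2}" for b1 b2
  have N: "finite (N b1 b2) \<and> card (N b1 b2) \<le> 1" if "auerbach_frame (diff_body K) w1 w2 b1 b2" for w1 w2 b1 b2
  proof -
    have "\<forall>y\<in>N b1 b2. \<forall>z\<in>N b1 b2. y = z"
      using quadrant_neighbour_unique[OF K that X x] Y unfolding N_def by blast
    then have "N b1 b2 = {} \<or> (\<exists>y. N b1 b2 = {y})"
      by blast
    then show ?thesis
      by auto
  qed
  have "Y \<subseteq> N a1 a2 \<union> N a2 (- a1) \<union> N (- a1) (- a2) \<union> N (- a2) a1"
  proof
    fix y assume y: "y \<in> Y"
    then have "y - x \<noteq> 0"
      using Y(1) by auto
    from quadrants_cover[OF fr this] y show "y \<in> N a1 a2 \<union> N a2 (- a1) \<union> N (- a1) (- a2) \<union> N (- a2) a1"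
      unfolding N_def by blast
  qed
  moreover have c: "finite (N a1 a2) \<and> card (N a1 a2) \<le> 1" "finite (N a2 (- a1)) \<and> card (N a2 (- a1)) \<le> 1"
    "finite (N (- a1) (- a2)) \<and> card (N (- a1) (- a2)) \<le> 1" "finite (N (- a2) a1) \<and> card (N (- a2) a1) \<le> 1"
    using N[OF fr] N[OF rot[OF fr]] N[OF rot[OF rot[OF fr]]] N[OF rot[OF rot[OF rot[OF fr]]]]
    by simp_all
  ultimately have "card Y \<le> card (N a1 a2 \<union> N a2 (- a1) \<union> N (- a1) (- a2) \<union> N (- a2) a1)"
    by (intro card_mono) auto
  also have "\<dots> \<le> card (N a1 a2) + card (N a2 (- a1)) + card (N (- a1) (- a2)) + card (N (- a2) a1)"
    by (meson add_le_mono card_Un_le le_refl le_trans)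
  finally show ?thesis
    using c by linarith
qed

section \<open>Lattice packings\<close>

text \<open>Frame coordinates of lattice points are integers, while those of \<open>D\<close> are at
  most 1. With \<open>t\<close> at the level of \<open>y\<close>, every point of \<open>X\<close> is
  at that level or below, or at least one unit above.\<close>

lemma tsep_lattice:
  assumes fr: "auerbach_frame D u1 u2 a1 a2"
    and X: "\<And>x. x \<in> X \<Longrightarrow> \<exists>i j. x = of_int i *\<^sub>R u1 + of_int j *\<^sub>R u2"
  shows "tsep D X"
  unfolding tsep_def
proof (intro ballI impI)
  fix y z assume yz: "y \<in> X" "z \<in> X" "y \<noteq> z"
  have bd: "a1 \<bullet> d \<le> 1" "a2 \<bullet> d \<le> 1" "- (a1 \<bullet> d) \<le> 1" "- (a2 \<bullet> d) \<le> 1" if "d \<in> D" for d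
    using fr that unfolding auerbach_frame_def by (auto simp: abs_le_iff)
  have int: "a1 \<bullet> x \<in> \<int>" "a2 \<bullet> x \<in> \<int>" if "x \<in> X" for x
    using X[OF that] fr unfolding auerbach_frame_def by (auto simp: inner_add_right)
  have sep: "\<exists>a t. a \<noteq> 0 \<and> a \<bullet> y \<le> t \<and> (\<forall>d\<in>D. t + a \<bullet> d \<le> a \<bullet> z) \<and>
        (\<forall>x\<in>X. a \<bullet> x \<le> t \<or> (\<forall>d\<in>D. t + a \<bullet> d \<le> a \<bullet> x))"
    if b: "\<And>x. x \<in> X \<Longrightarrow> b \<bullet> x \<in> \<int>" "\<And>d. d \<in> D \<Longrightarrow> b \<bullet> d \<le> 1" and lt: "b \<bullet> y < b \<bullet> z" for b
  proof -
    have step: "b \<bullet> y + 1 \<le> b \<bullet> x" if x: "x \<in> X" "b \<bullet> y < b \<bullet> x" for x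
    proof -
      obtain i j where "b \<bullet> y = of_int i" "b \<bullet> x = of_int j"
        using b(1)[OF yz(1)] b(1)[OF x(1)] by (metis Ints_cases)
      moreover from this have "i + 1 \<le> j"
        using x(2) by simp
      then have "real_of_int i + 1 \<le> real_of_int j"
        by linarith
      ultimately show ?thesis
        by simp
    qed
    have "b \<bullet> y + b \<bullet> d \<le> b \<bullet> x" if "x \<in> X" "b \<bullet> y < b \<bullet> x" "d \<in> D" for x d
      using step[OF that(1,2)] b(2)[OF that(3)] by linarith
    moreover have "b \<noteq> 0"
      using lt by auto
    ultimately show ?thesis
      using yz(2) lt by (intro exI[of _ b] exI[of _ "b \<bullet> y"]) (force simp: not_le)
  qed
  have "a1 \<bullet> y \<noteq> a1 \<bullet> z \<or> a2 \<bullet> y \<noteq> a2 \<bullet> z"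
    using fr yz(3) unfolding auerbach_frame_def by metis
  \<comment> \<open>\<open>tsep\<close> wants \<open>y\<close> on the lower side, so the sign of the
    differing coordinate is chosen accordingly.\<close>
  then consider "a1 \<bullet> y < a1 \<bullet> z" | "(- a1) \<bullet> y < (- a1) \<bullet> z" | "a2 \<bullet> y < a2 \<bullet> z"
    | "(- a2) \<bullet> y < (- a2) \<bullet> z"
    by fastforce
  then show "\<exists>a t. a \<noteq> 0 \<and> a \<bullet> y \<le> t \<and> (\<forall>d\<in>D. t + a \<bullet> d \<le> a \<bullet> z) \<and>
        (\<forall>x\<in>X. a \<bullet> x \<le> t \<or> (\<forall>d\<in>D. t + a \<bullet> d \<le> a \<bullet> x))"
    by cases (erule sep[rotated 2]; use int bd in \<open>simp\<close>)+
qed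

lemma H_sep_eq_4:
  fixes K :: "(real ^ 2) set"
  assumes K: "convex_body K" "smooth_body K"
  shows "H_sep K = 4"
proof -
  obtain u1 u2 a1 a2 where fr: "auerbach_frame (diff_body K) u1 u2 a1 a2"
    using auerbach_frame_exists[OF K(1)] .
  have K0: "K = (+) 0 ` K"
    by simp
  have "card T \<le> 4"
    if T: "finite T" "\<forall>A\<in>T. touch A K" "totally_separable_packing K (insert K T)" for T
  proof -
    \<comment> \<open>The translation vectors of the whole family; \<open>K\<close> itself
      corresponds to 0.\<close>
    define X where "X = {v. (+) v ` K \<in> insert K T}"
    have P: "insert K T = translates K X"
      unfolding X_def using T(3)
      by (intro family_eq_translates) (simp add: totally_separable_packing_def translative_packing_def)
    have X0: "0 \<in> X"
      unfolding X_def using K0 by simp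
    have "card Y \<le> 4" if Y: "Y = X - {0}" for Y
    proof (rule neighbours_le_4[OF K fr _ X0])
      show "tsep (diff_body K) X"
        using T(3) unfolding P totally_separable_iff_tsep[OF K(1)] .
      show "Y \<subseteq> X - {0}"
        using Y by simp
      show "y - 0 \<in> diff_body K" if "y \<in> Y" for y
      proof -
        have y: "y \<in> X" "y \<noteq> 0"
          using that Y by auto
        then have "(+) y ` K \<noteq> (+) 0 ` K"
          using injD[OF inj_translate[OF K(1)]] by blast
        then have "(+) y ` K \<in> T"
          using y(1) unfolding X_def by auto
        then have "(+) y ` K \<inter> (+) 0 ` K \<noteq> {}"
          using T(2) unfolding touch_def by auto
        then have "(+) 0 ` K \<inter> (+) y ` K \<noteq> {}"
          by blast
        then show ?thesis
          unfolding translates_inter_iff .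
      qed
    qed
    then have "card (X - {0}) \<le> 4"
      by simp
    moreover have "card (insert K T) = card X"
      unfolding P using card_translates[OF K(1)] .
    \<comment> \<open>\<open>K\<close> is not among its own neighbours, so the family has exactly
      \<open>card T + 1\<close> members.\<close>
    moreover have "K \<notin> T"
      using T(2) not_touch_self[OF K(1)] by blast
    moreover have "finite X"
      using T(1) P finite_translates_iff[OF K(1)] by (metis finite_insert)
    ultimately show ?thesis
      using T(1) X0 by (simp add: card_Diff_singleton)
  qed
  then have "H_sep K \<le> 4"
    unfolding H_sep_def by (intro Sup_least) (auto simp: numeral_eq_enat)
  moreover have "enat 4 \<le> H_sep K"
    unfolding H_sep_def
  proof (rule Sup_upper, intro CollectI exI conjI)
    \<comment> \<open>\<open>K\<close> and its four lattice neighbours along the frame attain the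
      bound.\<close>
    define Y where "Y = {u1, u2, - u1, - u2}"
    have d: "a1 \<bullet> u1 = 1" "a1 \<bullet> u2 = 0" "a2 \<bullet> u1 = 0" "a2 \<bullet> u2 = 1"
      using fr unfolding auerbach_frame_def by blast+
    have "u1 \<noteq> u2" "u1 \<noteq> - u2" "u2 \<noteq> - u1" "- u1 \<noteq> - u2" "u1 \<noteq> 0" "u2 \<noteq> 0"
      using d by auto
    moreover have "u1 \<noteq> - u1" "u2 \<noteq> - u2"
      using d by (metis inner_minus_right one_neq_neg_one)+
    ultimately have cY: "card Y = 4" "0 \<notin> Y" "finite Y"
      unfolding Y_def by auto
    have YD: "y \<in> diff_body K" if "y \<in> Y" for y
      using that fr diff_body_uminus unfolding Y_def auerbach_frame_def by blast
    show "enat 4 = enat (card (translates K Y))"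
      using card_translates[OF K(1)] cY by simp
    show "finite (translates K Y)"
      using finite_translates_iff[OF K(1)] cY by simp
    have P: "insert K (translates K Y) = translates K (insert 0 Y)"
      unfolding translates_def by simp
    have "tsep (diff_body K) (insert 0 Y)"
    proof (rule tsep_lattice[OF fr])
      fix x assume "x \<in> insert 0 Y"
      then consider "x = 0" | "x = u1" | "x = u2" | "x = - u1" | "x = - u2"
        unfolding Y_def by blast
      then show "\<exists>i j. x = of_int i *\<^sub>R u1 + of_int j *\<^sub>R u2"
      proof cases
        case 1 then show ?thesis by (intro exI[of _ 0] exI[of _ 0]) simp
      next
        case 2 then show ?thesis by (intro exI[of _ 1] exI[of _ 0]) simp
      next
        case 3 then show ?thesis by (intro exI[of _ 0] exI[of _ 1]) simp
      next
        case 4 then show ?thesis by (intro exI[of _ "-1"] exI[of _ 0]) simp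
      next
        case 5 then show ?thesis by (intro exI[of _ 0] exI[of _ "-1"]) simp
      qed
    qed
    then show ts: "totally_separable_packing K (insert K (translates K Y))"
      unfolding P totally_separable_iff_tsep[OF K(1)] .
    show "\<forall>A\<in>translates K Y. touch A K"
    proof
      fix A assume "A \<in> translates K Y"
      then obtain y where y: "y \<in> Y" "A = (+) y ` K"
        unfolding translates_def by blast
      have "touch ((+) y ` K) ((+) 0 ` K)"
        using touch_translates_iff[OF K(1) ts[unfolded P], of y 0] y(1) cY(2) diff_body_uminus[OF YD[OF y(1)]]
        by auto
      then show "touch A K"
        using y by simp
    qed
  qed
  ultimately show ?thesis
    by (simp add: numeral_eq_enat antisym)
qed

section \<open>The number of contacts\<close>

text \<open>Contacts directed into one quadrant. Together with those of the next quadrant they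
  orient every contact exactly once.\<close>

definition quadrant_edges :: "'a::euclidean_space set \<Rightarrow> 'a set \<Rightarrow> 'a \<Rightarrow> 'a \<Rightarrow> ('a \<times> 'a) set" where
  "quadrant_edges D X a1 a2 = {(x, y). x \<in> X \<and> y \<in> X \<and> y - x \<in> D \<and> y - x \<in> quadrant a1 a2}"

lemma single_valued_quadrant_edges:
  assumes "convex_body K" "smooth_body K" "auerbach_frame (diff_body K) u1 u2 a1 a2"
    "tsep (diff_body K) X"
  shows "single_valued (quadrant_edges (diff_body K) X a1 a2)"
  using quadrant_neighbour_unique[OF assms] unfolding single_valued_def quadrant_edges_def by blast

text \<open>Reversal passes to the opposite quadrant, itself a rotated one, so in-degrees obey the
  same bound as out-degrees.\<close>

lemma converse_quadrant_edges:
  "(quadrant_edges (diff_body K) X a1 a2)\<inverse> = quadrant_edges (diff_body K) X (- a1) (- a2)"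
  unfolding quadrant_edges_def quadrant_def
  by (auto simp: inner_diff_right intro: diff_body_minus_commute)

text \<open>Walking edges backwards lowers \<open>f\<close>, so in a finite set the walk ends at a
  point without predecessor. The induction counts the points lying lower.\<close>

lemma ex_source:
  fixes f :: "'a \<Rightarrow> real"
  assumes X: "finite X" "E \<subseteq> X \<times> X" and f: "\<And>x y. (x, y) \<in> E \<Longrightarrow> f x < f y" and x: "x \<in> X"
  shows "\<exists>r\<in>X - Range E. (r, x) \<in> E\<^sup>*"
  using x
proof (induction "card {y \<in> X. f y < f x}" arbitrary: x rule: less_induct)
  case less
  show ?case
  proof (cases "x \<in> Range E")
    case False
    then show ?thesis
      using less.prems by blast
  next
    case True
    then obtain w where w: "(w, x) \<in> E"
      by blast
    then have "w \<in> X" "f w < f x"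
      using X(2) f by auto
    then have "{y \<in> X. f y < f w} \<subset> {y \<in> X. f y < f x}"
      by fastforce
    then have "card {y \<in> X. f y < f w} < card {y \<in> X. f y < f x}"
      using X(1) by (intro psubset_card_mono) auto
    then obtain r where "r \<in> X - Range E" "(r, w) \<in> E\<^sup>*"
      using less.hyps \<open>w \<in> X\<close> by blast
    then show ?thesis
      using w by (meson rtrancl.rtrancl_into_rtrancl)
  qed
qed

text \<open>With in-degree at most one, an edge is determined by its head, so edges correspond to
  the points that are not sources.\<close>

lemma card_sources:
  assumes "finite X" "E \<subseteq> X \<times> X" "single_valued (E\<inverse>)"
  shows "card E + card (X - Range E) = card X"
proof -
  have "inj_on snd E"
    using assms(3) unfolding inj_on_def single_valued_def by fastforce
  then have "card (Range E) = card E"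
    unfolding Range_snd by (rule card_image)
  moreover have "Range E \<subseteq> X"
    using assms(2) by auto
  ultimately show ?thesis
    using assms(1) by (metis card_Diff_subset card_mono finite_subset le_add_diff_inverse)
qed

text \<open>A path inherits the monotonicity of its edges; this later prevents two points from
  sharing a path of each kind.\<close>

lemma rtrancl_quadrant_edges:
  assumes "(x, y) \<in> (quadrant_edges D X a1 a2)\<^sup>*" "x \<noteq> y"
  shows "a1 \<bullet> x < a1 \<bullet> y \<and> a2 \<bullet> x \<le> a2 \<bullet> y"
proof -
  have "x = y \<or> a1 \<bullet> x < a1 \<bullet> y \<and> a2 \<bullet> x \<le> a2 \<bullet> y"
    using assms(1)
    by (induction rule: rtrancl_induct) (auto simp: quadrant_edges_def quadrant_def inner_diff_right)
  then show ?thesis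
    using assms(2) by blast
qed

text \<open>A point is determined by the sources of its two paths: distinct points with the same
  pair of sources would be comparable along both kinds of path, with contradictory coordinate
  inequalities.\<close>

lemma card_le_sources:
  assumes K: "convex_body K" "smooth_body K"
    and fr: "auerbach_frame (diff_body K) u1 u2 a1 a2"
    and X: "tsep (diff_body K) X" "finite X"
  defines "E \<equiv> quadrant_edges (diff_body K) X a1 a2"
    and "F \<equiv> quadrant_edges (diff_body K) X a2 (- a1)"
  shows "card X \<le> card (X - Range E) * card (X - Range F)"
proof -
  have sub: "E \<subseteq> X \<times> X" "F \<subseteq> X \<times> X"
    unfolding E_def F_def quadrant_edges_def by auto
  \<comment> \<open>The first coordinate strictly increases along \<open>E\<close>, as the second
    does along \<open>F\<close>.\<close>
  have "\<exists>r\<in>X - Range E. (r, x) \<in> E\<^sup>*" if "x \<in> X" for x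
    using X(2) sub(1) _ that
    by (rule ex_source[where f = "\<lambda>v. a1 \<bullet> v"])
      (auto simp: E_def quadrant_edges_def quadrant_def inner_diff_right)
  then obtain r where r: "\<And>x. x \<in> X \<Longrightarrow> r x \<in> X - Range E \<and> (r x, x) \<in> E\<^sup>*"
    by metis
  have "\<exists>s\<in>X - Range F. (s, x) \<in> F\<^sup>*" if "x \<in> X" for x
    using X(2) sub(2) _ that
    by (rule ex_source[where f = "\<lambda>v. a2 \<bullet> v"])
      (auto simp: F_def quadrant_edges_def quadrant_def inner_diff_right)
  then obtain s where s: "\<And>x. x \<in> X \<Longrightarrow> s x \<in> X - Range F \<and> (s x, x) \<in> F\<^sup>*"
    by metis
  have sv: "single_valued E" "single_valued F"
    unfolding E_def F_def using single_valued_quadrant_edges[OF K _ X(1)] fr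
      auerbach_frame_rotate[OF fr] by blast+
  have "inj_on (\<lambda>x. (r x, s x)) X"
  proof (rule inj_onI)
    fix x y assume xy: "x \<in> X" "y \<in> X" "(r x, s x) = (r y, s y)"
    \<comment> \<open>Out-degree at most one means that two points reached from the same source lie
      on one path.\<close>
    have "(x, y) \<in> E\<^sup>* \<or> (y, x) \<in> E\<^sup>*"
      using single_valued_confluent[OF sv(1), of "r x" x y] r xy by auto
    moreover have "(x, y) \<in> F\<^sup>* \<or> (y, x) \<in> F\<^sup>*"
      using single_valued_confluent[OF sv(2), of "s x" x y] s xy by auto
    ultimately show "x = y"
      using rtrancl_quadrant_edges[of _ _ "diff_body K" X a1 a2]
        rtrancl_quadrant_edges[of _ _ "diff_body K" X a2 "- a1"]
      unfolding E_def[symmetric] F_def[symmetric] by fastforce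
  qed
  moreover have "(\<lambda>x. (r x, s x)) ` X \<subseteq> (X - Range E) \<times> (X - Range F)"
    using r s by auto
  ultimately have "card X \<le> card ((X - Range E) \<times> (X - Range F))"
    using X(2) by (intro card_inj_on_le) auto
  then show ?thesis
    by (simp add: card_cartesian_product)
qed

section \<open>Upper bound for the number of contacts\<close>

text \<open>Every contact can be directed into the first or second quadrant, because these and their
  negatives cover all nonzero vectors.\<close>

lemma contact_edges_eq:
  assumes K: "convex_body K" "totally_separable_packing K (translates K X)"
    and fr: "auerbach_frame (diff_body K) u1 u2 a1 a2"
  shows "contact_edges (translates K X) = (\<lambda>(x, y). {(+) x ` K, (+) y ` K}) `
    (quadrant_edges (diff_body K) X a1 a2 \<union> quadrant_edges (diff_body K) X a2 (- a1))" (is "?L = ?g ` ?E")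
proof
  show "?L \<subseteq> ?g ` ?E"
  proof
    fix e assume "e \<in> ?L"
    then obtain x y where e: "x \<in> X" "y \<in> X" "(+) x ` K \<noteq> (+) y ` K"
      "touch ((+) x ` K) ((+) y ` K)" "e = {(+) x ` K, (+) y ` K}"
      unfolding contact_edges_def translates_def by blast
    have ne: "x \<noteq> y"
      using e(3) by blast
    have "y - x \<in> diff_body K"
      using e(4) touch_translates_iff[OF K e(1,2) ne] by blast
    moreover from this have "x - y \<in> diff_body K"
      by (rule diff_body_minus_commute)
    moreover have "y - x \<in> quadrant a1 a2 \<union> quadrant a2 (- a1) \<union> quadrant (- a1) (- a2) \<union> quadrant (- a2) a1"
      using quadrants_cover[OF fr, of "y - x"] ne by simp
    then have "y - x \<in> quadrant a1 a2 \<union> quadrant a2 (- a1) \<or> x - y \<in> quadrant a1 a2 \<union> quadrant a2 (- a1)"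
      by (auto simp: quadrant_def inner_diff_right)
    ultimately have "(x, y) \<in> ?E \<or> (y, x) \<in> ?E"
      using e(1,2) unfolding quadrant_edges_def by blast
    then show "e \<in> ?g ` ?E"
    proof
      assume "(x, y) \<in> ?E"
      then show ?thesis
        using e(5) by (intro image_eqI[of _ _ "(x, y)"]) auto
    next
      assume "(y, x) \<in> ?E"
      then show ?thesis
        using e(5) by (intro image_eqI[of _ _ "(y, x)"]) auto
    qed
  qed
  show "?g ` ?E \<subseteq> ?L"
  proof
    fix e assume "e \<in> ?g ` ?E"
    then obtain x y where e: "x \<in> X" "y \<in> X" "y - x \<in> diff_body K"
      "y - x \<in> quadrant a1 a2 \<union> quadrant a2 (- a1)" "e = {(+) x ` K, (+) y ` K}"
      unfolding quadrant_edges_def by auto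
    have ne: "x \<noteq> y"
      using e(4) by (auto simp: quadrant_def)
    then have "(+) x ` K \<noteq> (+) y ` K"
      using injD[OF inj_translate[OF K(1)]] by blast
    moreover have "touch ((+) x ` K) ((+) y ` K)"
      using touch_translates_iff[OF K e(1,2) ne] e(3) by blast
    ultimately show "e \<in> ?L"
      using e unfolding contact_edges_def translates_def by blast
  qed
qed

text \<open>The direction is unique: the first two quadrants are disjoint, and their union never
  contains a vector together with its negative. So nothing is counted twice.\<close>

lemma card_contact_edges:
  assumes K: "convex_body K" "totally_separable_packing K (translates K X)" and X: "finite X"
    and fr: "auerbach_frame (diff_body K) u1 u2 a1 a2"
  shows "card (contact_edges (translates K X)) =
    card (quadrant_edges (diff_body K) X a1 a2) + card (quadrant_edges (diff_body K) X a2 (- a1))"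
    (is "_ = card ?E + card ?F")
proof -
  have "inj_on (\<lambda>(x, y). {(+) x ` K, (+) y ` K}) (?E \<union> ?F)"
  proof (rule inj_onI)
    fix p q assume pq: "p \<in> ?E \<union> ?F" "q \<in> ?E \<union> ?F"
      "(\<lambda>(x, y). {(+) x ` K, (+) y ` K}) p = (\<lambda>(x, y). {(+) x ` K, (+) y ` K}) q"
    obtain x y x' y' where p: "p = (x, y)" "q = (x', y')"
      by (metis surj_pair)
    have "x = x' \<and> y = y' \<or> x = y' \<and> y = x'"
      using pq(3) injD[OF inj_translate[OF K(1)]] unfolding p by (simp add: doubleton_eq_iff) blast
    moreover have "\<not> (x = y' \<and> y = x')"
      using pq(1,2) unfolding p quadrant_edges_def quadrant_def by (auto simp: inner_diff_right)
    ultimately show "p = q"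
      using p by blast
  qed
  then have "card (contact_edges (translates K X)) = card (?E \<union> ?F)"
    unfolding contact_edges_eq[OF K fr] by (rule card_image)
  also have "\<dots> = card ?E + card ?F"
  proof (rule card_Un_disjoint)
    show "finite ?E" "finite ?F"
      by (rule finite_subset[of _ "X \<times> X"]; use X in \<open>auto simp: quadrant_edges_def\<close>)+
    show "?E \<inter> ?F = {}"
      by (auto simp: quadrant_edges_def quadrant_def)
  qed
  finally show ?thesis .
qed

lemma contact_edges_upper_bound:
  fixes K :: "(real ^ 2) set"
  assumes K: "convex_body K" "smooth_body K" and P: "totally_separable_packing K P" "finite P"
  shows "real (card (contact_edges P)) \<le> 2 * real (card P) - 2 * sqrt (real (card P))"
proof -
  obtain u1 u2 a1 a2 where fr: "auerbach_frame (diff_body K) u1 u2 a1 a2"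
    using auerbach_frame_exists[OF K(1)] .
  note rot = auerbach_frame_rotate
  define X where "X = {v. (+) v ` K \<in> P}"
  have PX: "P = translates K X"
    unfolding X_def using P(1)
    by (intro family_eq_translates) (simp add: totally_separable_packing_def translative_packing_def)
  have X: "finite X" "card P = card X" "tsep (diff_body K) X"
    using P finite_translates_iff[OF K(1)] card_translates[OF K(1)] totally_separable_iff_tsep[OF K(1)]
    unfolding PX by auto
  define E where "E = quadrant_edges (diff_body K) X a1 a2"
  define F where "F = quadrant_edges (diff_body K) X a2 (- a1)"
  define p where "p = card (X - Range E)"
  define q where "q = card (X - Range F)"
  \<comment> \<open>In-degrees: the reversed edges belong to the frame turned twice for
    \<open>E\<close> and three times for \<open>F\<close>.\<close>
  have "single_valued (E\<inverse>)" "single_valued (F\<inverse>)"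
    unfolding E_def F_def converse_quadrant_edges
    using single_valued_quadrant_edges[OF K _ X(3)] fr rot[OF rot[OF fr]] rot[OF rot[OF rot[OF fr]]]
    by fastforce+
  moreover have "E \<subseteq> X \<times> X" "F \<subseteq> X \<times> X"
    unfolding E_def F_def quadrant_edges_def by auto
  ultimately have "card E + p = card X" "card F + q = card X"
    unfolding p_def q_def using card_sources[OF X(1)] by blast+
  moreover have "card (contact_edges P) = card E + card F"
    using card_contact_edges[OF K(1) P(1)[unfolded PX] X(1) fr] unfolding PX E_def F_def .
  ultimately have c: "card (contact_edges P) + p + q = 2 * card P"
    using X(2) by linarith
  have "card P \<le> p * q"
    using card_le_sources[OF K fr X(3,1)] unfolding p_def q_def E_def F_def X(2) .
  then have "real (card P) \<le> real p * real q"
    by (metis of_nat_le_iff of_nat_mult)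
  then have "sqrt (real (card P)) \<le> sqrt (real p * real q)"
    by simp
  \<comment> \<open>The arithmetic-geometric mean inequality converts the bound on the product into
    one on \<open>p + q\<close>.\<close>
  also have "\<dots> \<le> (real p + real q) / 2"
    by (rule arith_geo_mean_sqrt) auto
  finally show ?thesis
    using arg_cong[OF c, of real] by simp
qed

section \<open>Near-square pieces of the lattice\<close>

text \<open>A lattice piece of at most \<open>r\<close> rows of length \<open>q\<close>, filled row
  by row. All elements but the row starts have a left neighbour, and all outside the first row have
  one below, giving at least \<open>(n - r) + (n - q)\<close> contacts.\<close>

lemma grid_contacts:
  fixes K :: "(real ^ 2) set"
  assumes K: "convex_body K" and q: "2 \<le> q" "q \<le> n" "n \<le> r * q"
  shows "\<exists>P. finite P \<and> card P = n \<and> totally_separable_packing K P \<and>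
      2 * n \<le> card (contact_edges P) + q + r"
proof -
  obtain u1 u2 a1 a2 where fr: "auerbach_frame (diff_body K) u1 u2 a1 a2"
    using auerbach_frame_exists[OF K] .
  have d: "u1 \<in> diff_body K" "u2 \<in> diff_body K" "a1 \<bullet> u1 = 1" "a1 \<bullet> u2 = 0" "a2 \<bullet> u1 = 0" "a2 \<bullet> u2 = 1"
    using fr unfolding auerbach_frame_def by blast+
  define g where "g k = real (k mod q) *\<^sub>R u1 + real (k div q) *\<^sub>R u2" for k
  define X where "X = g ` {..<n}"
  have "inj g"
  proof (rule injI)
    fix k l assume "g k = g l"
    then have "a1 \<bullet> g k = a1 \<bullet> g l" "a2 \<bullet> g k = a2 \<bullet> g l"
      by simp_all
    then have "k mod q = l mod q" "k div q = l div q"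
      by (simp_all add: g_def inner_add_right d)
    then show "k = l"
      by (metis div_mult_mod_eq)
  qed
  then have X: "finite X" "card X = n"
    unfolding X_def by (simp_all add: card_image inj_on_subset)
  have "tsep (diff_body K) X"
  proof (rule tsep_lattice[OF fr])
    fix x assume "x \<in> X"
    then obtain k where "x = g k"
      unfolding X_def by blast
    then show "\<exists>i j. x = of_int i *\<^sub>R u1 + of_int j *\<^sub>R u2"
      by (intro exI[of _ "int (k mod q)"] exI[of _ "int (k div q)"]) (simp add: g_def)
  qed
  then have ts: "totally_separable_packing K (translates K X)"
    unfolding totally_separable_iff_tsep[OF K] .
  define E where "E = quadrant_edges (diff_body K) X a1 a2"
  define F where "F = quadrant_edges (diff_body K) X a2 (- a1)"
  have fin: "finite E" "finite F"
    unfolding E_def F_def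
    by (rule finite_subset[of _ "X \<times> X"]; use X in \<open>auto simp: quadrant_edges_def\<close>)+
  have "(\<lambda>l. (g (l - 1), g l)) ` {l\<in>{..<n}. l mod q \<noteq> 0} \<subseteq> E"
  proof (rule image_subsetI)
    fix l assume "l \<in> {l\<in>{..<n}. l mod q \<noteq> 0}"
    then have l: "l < n" "l mod q \<noteq> 0"
      by simp_all
    then have l0: "l > 0"
      by (cases l) auto
    \<comment> \<open>\<open>l\<close> does not start a row, so going back one index keeps the row
      and lowers the column by one.\<close>
    have "Suc (l - 1) mod q \<noteq> 0"
      using l l0 by simp
    then have "Suc (l - 1) mod q = Suc ((l - 1) mod q)" "Suc (l - 1) div q = (l - 1) div q"
      by (simp_all add: mod_Suc div_Suc split: if_splits)
    then have "g l - g (l - 1) = u1"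
      using l0 by (simp add: g_def algebra_simps)
    then show "(g (l - 1), g l) \<in> E"
      using l d unfolding E_def quadrant_edges_def quadrant_def X_def by auto
  qed
  then have "card ((\<lambda>l. (g (l - 1), g l)) ` {l\<in>{..<n}. l mod q \<noteq> 0}) \<le> card E"
    using fin by (intro card_mono)
  moreover have "inj_on (\<lambda>l. (g (l - 1), g l)) {l\<in>{..<n}. l mod q \<noteq> 0}"
    using \<open>inj g\<close> by (auto simp: inj_on_def)
  ultimately have E: "card {l\<in>{..<n}. l mod q \<noteq> 0} \<le> card E"
    by (simp add: card_image)
  \<comment> \<open>Row starts are multiples of \<open>q\<close>, and \<open>n \<le> r * q\<close>
    leaves at most \<open>r\<close> of them.\<close>
  have "{l\<in>{..<n}. l mod q = 0} \<subseteq> (\<lambda>i. i * q) ` {..<r}"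
  proof
    fix l assume "l \<in> {l\<in>{..<n}. l mod q = 0}"
    then have l: "l < n" "l = (l div q) * q"
      by auto
    then have "l div q < r"
      using q by (simp add: less_mult_imp_div_less)
    then show "l \<in> (\<lambda>i. i * q) ` {..<r}"
      using l by blast
  qed
  then have "card {l\<in>{..<n}. l mod q = 0} \<le> r"
    using surj_card_le[of "{..<r}" "{l\<in>{..<n}. l mod q = 0}"] by simp
  moreover have "card {l\<in>{..<n}. l mod q = 0} + card {l\<in>{..<n}. l mod q \<noteq> 0} = n"
    using card_Int_Diff[of "{..<n}" "{l. l mod q = 0}"]
    by (simp add: Int_def set_diff_eq)
  ultimately have E': "n \<le> card E + r"
    using E by simp
  \<comment> \<open>Going back \<open>q\<close> indices leads to the cell below.\<close>
  have "(\<lambda>l. (g (l - q), g l)) ` {q..<n} \<subseteq> F"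
  proof (rule image_subsetI)
    fix l assume l: "l \<in> {q..<n}"
    have "l mod q = (l - q) mod q" "l div q = Suc ((l - q) div q)"
      using l q by (simp_all add: le_mod_geq le_div_geq)
    then have "g l - g (l - q) = u2"
      by (simp add: g_def algebra_simps)
    then show "(g (l - q), g l) \<in> F"
      using l d unfolding F_def quadrant_edges_def quadrant_def X_def by auto
  qed
  then have "card ((\<lambda>l. (g (l - q), g l)) ` {q..<n}) \<le> card F"
    using fin by (intro card_mono)
  moreover have "inj_on (\<lambda>l. (g (l - q), g l)) {q..<n}"
    using \<open>inj g\<close> by (auto simp: inj_on_def)
  ultimately have F: "n - q \<le> card F"
    by (simp add: card_image)
  have "card (contact_edges (translates K X)) = card E + card F"
    unfolding E_def F_def using card_contact_edges[OF K ts X(1) fr] .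
  \<comment> \<open>\<open>q \<le> n\<close> ensures that the natural-number difference
    \<open>n - q\<close> is not truncated.\<close>
  then have "2 * n \<le> card (contact_edges (translates K X)) + q + r"
    using E' F q by linarith
  then show ?thesis
    using X ts finite_translates_iff[OF K] card_translates[OF K] by (intro exI[of _ "translates K X"]) simp
qed

text \<open>\<open>q\<close> is the square root of \<open>n\<close> rounded up; the number of rows
  is \<open>q - 1\<close> when that suffices and \<open>q\<close> otherwise.\<close>

lemma near_square_dimensions:
  assumes "n \<ge> (2::nat)"
  shows "\<exists>q r. 2 \<le> q \<and> q \<le> n \<and> n \<le> r * q \<and> real (q + r) < 2 * sqrt (real n) + 1"
proof -
  define q where "q = (LEAST q. n \<le> q * q)"
  have nq: "n \<le> q * q"
    unfolding q_def by (rule LeastI[of _ n]) simp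
  have q2: "q \<ge> 2"
  proof (rule ccontr)
    assume "\<not> q \<ge> 2"
    then have "q * q \<le> 1 * 1"
      by (intro mult_le_mono) auto
    then show False
      using nq assms by simp
  qed
  then obtain m where m: "q = Suc m" "m \<ge> 1"
    by (cases q) auto
  have lt: "m * m < n"
    using not_less_Least[of m "\<lambda>q. n \<le> q * q"] m(1) unfolding q_def by auto
  have "m \<le> m * m"
    by simp
  then have qn: "q \<le> n"
    using lt m(1) by linarith
  have rlt: "x < sqrt (real n)" if "x ^ 2 < real n" for x
    using that by (simp add: real_less_rsqrt)
  show ?thesis
  proof (cases "n \<le> m * q")
    case True
    have "real m < sqrt (real n)"
      using lt by (intro rlt) (simp add: power2_eq_square flip: of_nat_mult)
    then have "real (q + m) < 2 * sqrt (real n) + 1"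
      using m by simp
    then show ?thesis
      using True q2 qn by blast
  next
    case False
    \<comment> \<open>Integrality gives the final 1, which exceeds the 1/4 in the square of
      \<open>m + 1/2\<close>.\<close>
    then have "n \<ge> m * m + m + 1"
      using m by simp
    then have "real n \<ge> real m * real m + real m + 1"
      by (metis of_nat_1 of_nat_add of_nat_le_iff of_nat_mult)
    then have "(real m + 1/2) ^ 2 < real n"
      by (simp add: power2_eq_square algebra_simps)
    then have "real m + 1/2 < sqrt (real n)"
      by (rule rlt)
    then have "real (q + q) < 2 * sqrt (real n) + 1"
      using m by simp
    then show ?thesis
      using nq q2 qn by blast
  qed
qed

lemma c_sep_eq:
  fixes K :: "(real ^ 2) set"
  assumes K: "convex_body K" "smooth_body K" and n: "n \<ge> 2"
  shows "int (c_sep K n) = \<lfloor>2 * real n - 2 * sqrt (real n)\<rfloor>"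
proof -
  define S where "S = {card (contact_edges P) | P. finite P \<and> card P = n \<and> totally_separable_packing K P}"
  have fin: "finite S"
    unfolding S_def by (rule finite_contact_numbers)
  obtain q r where q: "2 \<le> q" "q \<le> n" "n \<le> r * q" "real (q + r) < 2 * sqrt (real n) + 1"
    using near_square_dimensions[OF n] by blast
  obtain P where P: "finite P" "card P = n" "totally_separable_packing K P"
    "2 * n \<le> card (contact_edges P) + q + r"
    using grid_contacts[OF K(1) q(1-3)] by blast
  have PS: "card (contact_edges P) \<in> S"
    unfolding S_def using P by blast
  have "card (contact_edges P) \<le> Max S"
    using Max_ge[OF fin PS] .
  then have "2 * n \<le> Max S + (q + r)"
    using P(4) by linarith
  then have "2 * real n \<le> real (Max S) + real (q + r)"
    by (metis of_nat_add of_nat_le_iff of_nat_mult of_nat_numeral)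
  \<comment> \<open>The strict bound on \<open>q + r\<close> puts the real value below
    \<open>Max S + 1\<close>; with the upper bound this pins down the floor.\<close>
  then have "2 * real n - 2 * sqrt (real n) < real (Max S) + 1"
    using q(4) by linarith
  moreover have "Max S \<in> S"
    using Max_in[OF fin] PS by blast
  then have "real (Max S) \<le> 2 * real n - 2 * sqrt (real n)"
    using contact_edges_upper_bound[OF K] unfolding S_def by auto
  moreover have "c_sep K n = Max S"
    unfolding c_sep_def S_def ..
  ultimately show ?thesis
    by (intro floor_unique[symmetric]) simp_all
qed

theorem theorem1:
  "(\<forall>K :: (real ^ 2) set. convex_body K \<and> smooth_body K \<longrightarrow> H_sep K = 4) \<and>
   (\<forall>(K :: (real ^ 2) set) (n :: nat).
      convex_body K \<and> smooth_body K \<and> strictly_convex_body K \<and> n \<ge> 2 \<longrightarrow>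
        int (c_sep K n) = \<lfloor>2 * real n - 2 * sqrt (real n)\<rfloor>)"
  using H_sep_eq_4 c_sep_eq by blast

end
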